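(* Let $k \geq 3$ and let $A = \{a_1, a_2, \ldots, a_k\}$ be a set of $k$ positive integers with $a_1 < a_2 < \cdots < a_k$ and $d(A) = 1$. Then \[ |S(A)| \geq \begin{cases} a_k + \dfrac{k(k-1)}{2} & \text{if } a_k \leq 2k-3,\\[2mm] \theta(k+1) - 4 + \dfrac{k(k-1)}{2} & \text{if } a_k \geq 2k-2. \end{cases} \]
   Context: For a nonempty finite set $A$ of integers, $S(A) = \{\sum_{b\in B} b : \emptyset \neq B \subseteq A\}$ is the set of all nonempty subset sums of $A$. $d(A)$ denotes the greatest common divisor of the elements of $A$. $\theta = \frac{1+\sqrt{5}}{2}$ is the golden mean. *)

theory Defs
  imports Complex_Main
begin

definition subset_sums :: "int set \<Rightarrow> int set" where
  "subset_sums A = {\<Sum>b\<in>B. b | B. B \<noteq> {} \<and> B \<subseteq> A}"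

definition golden_mean :: real where
  "golden_mean = (1 + sqrt 5) / 2"

end

theory Submission
  imports Defs
begin

text \<open>
  Let \<open>m = a\<^sub>k\<close>, \<open>B = A - {m}\<close> and count the empty sum as well. Adjoining \<open>m\<close> to \<open>B\<close> creates at
  least one new subset sum for every residue class modulo \<open>m\<close> met by the subset sums of \<open>B\<close>: add
  \<open>m\<close> to the largest sum in that class. Since \<open>B\<close> has at least \<open>1 + k(k-1)/2\<close> subset sums, it is
  enough to see that they meet at least \<open>min m (2k-3)\<close> residue classes.

  For this, let \<open>S\<close> be the set of subset sums of \<open>B\<close> modulo \<open>m\<close>. By induction on \<open>|B|\<close>, either
  \<open>|S| \<ge> 2|B| - 1\<close> or \<open>S\<close> is the subgroup generated by \<open>B\<close>, which is everything as \<open>Gcd A = 1\<close>.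
  The induction step is immediate if removing some \<open>c\<close> from \<open>B\<close> costs at least two sums, or leaves
  a subgroup not containing \<open>c\<close>. Otherwise each \<open>c \<in> B\<close> has a unique \<open>q \<in> S\<close> with \<open>q + c \<notin> S\<close>.
  Comparing two elements \<open>b \<noteq> \<plusminus>c\<close> of \<open>B\<close> shows that this gap \<open>q + c\<close> is the same point \<open>y\<close> for
  all of \<open>B\<close>, so \<open>S \<union> {y}\<close> is the subgroup, and a pigeonhole argument bounds its order from below.
\<close>

section \<open>Subset sums with the empty sum included, and their residues\<close>

text \<open>Including the empty sum makes adjoining an element a union with a single
  translate.\<close>

definition sums0 :: "int set \<Rightarrow> int set" where
  "sums0 B = \<Sum> ` Pow B"

definition msums :: "int \<Rightarrow> int set \<Rightarrow> int set" where
  "msums m B = (\<lambda>x. x mod m) ` sums0 B"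

lemma finite_sums0 [simp]: "finite B \<Longrightarrow> finite (sums0 B)"
  by (simp add: sums0_def)

lemma finite_msums [simp]: "finite B \<Longrightarrow> finite (msums m B)"
  by (simp add: msums_def)

lemma sums0_empty [simp]: "sums0 {} = {0}"
  by (simp add: sums0_def)

lemma zero_in_sums0: "0 \<in> sums0 B"
  unfolding sums0_def by (rule image_eqI[of _ _ "{}"]) auto

lemma subset_sums0: "B \<subseteq> sums0 B"
proof
  fix b assume "b \<in> B"
  then show "b \<in> sums0 B"
    unfolding sums0_def by (intro image_eqI[of _ _ "{b}"]) auto
qed

lemma sums0_insert:
  assumes "finite B" "b \<notin> B"
  shows "sums0 (insert b B) = sums0 B \<union> (\<lambda>x. x + b) ` sums0 B"
proof -
  have "\<Sum> (insert b X) = \<Sum> X + b" if "X \<in> Pow B" for X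
    using that assms finite_subset[of X B] by (subst sum.insert) auto
  then have "(\<lambda>X. \<Sum> (insert b X)) ` Pow B = (\<lambda>X. \<Sum> X + b) ` Pow B"
    by (intro image_cong) auto
  then show ?thesis
    by (simp add: sums0_def Pow_insert image_Un image_image)
qed

lemma msums_insert:
  assumes "finite B" "b \<notin> B"
  shows "msums m (insert b B) = msums m B \<union> (\<lambda>x. (x + b) mod m) ` msums m B"
  unfolding msums_def sums0_insert[OF assms] by (simp add: image_Un image_image mod_simps)

lemma msums_subset: "m > 0 \<Longrightarrow> msums m B \<subseteq> {0..<m}"
  by (auto simp: msums_def)

lemma residues_subset_msums:
  assumes "m > 0" "B \<subseteq> {0<..<m}"
  shows "insert 0 B \<subseteq> msums m B"
proof -
  have "x \<in> msums m B" if "x \<in> insert 0 B" for x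
  proof -
    have "x \<in> sums0 B" "x mod m = x"
      using that assms zero_in_sums0 subset_sums0[of B] by auto
    then show ?thesis unfolding msums_def by force
  qed
  then show ?thesis by blast
qed

lemma card_msums_ge_Suc:
  assumes "m > 0" "B \<subseteq> {0<..<m}" "finite B"
  shows "Suc (card B) \<le> card (msums m B)"
proof -
  have "card (insert 0 B) \<le> card (msums m B)"
    using assms residues_subset_msums by (intro card_mono) auto
  moreover have "0 \<notin> B" using assms by auto
  ultimately show ?thesis using assms by simp
qed

section \<open>Sums gained by adjoining a positive element\<close>

text \<open>The largest element \<open>g r\<close> of \<open>T\<close> in the class \<open>r\<close>
  leaves \<open>T\<close> when shifted by \<open>b\<close>. The shifted points are distinct, since
  each still has residue \<open>r\<close>.\<close>

lemma card_Un_translate: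
  fixes b :: int
  assumes "finite T" "b > 0"
  shows "card T + card ((\<lambda>x. x mod b) ` T) \<le> card (T \<union> (\<lambda>x. x + b) ` T)"
proof -
  define g where "g r = Max {x \<in> T. x mod b = r}" for r
  let ?R = "(\<lambda>x. x mod b) ` T"
  have g: "g r \<in> T" "g r mod b = r" "g r + b \<notin> T" if "r \<in> ?R" for r
  proof -
    have fin: "finite {x \<in> T. x mod b = r}" using assms by simp
    have "g r \<in> {x \<in> T. x mod b = r}"
      unfolding g_def using that fin by (intro Max_in) auto
    then show "g r \<in> T" "g r mod b = r" by auto
    show "g r + b \<notin> T"
    proof
      assume "g r + b \<in> T"
      then have "g r + b \<in> {x \<in> T. x mod b = r}" using \<open>g r mod b = r\<close> by simp
      then have "g r + b \<le> g r" unfolding g_def using fin by (intro Max_ge) auto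
      then show False using assms by simp
    qed
  qed
  have "inj_on (\<lambda>r. g r + b) ?R"
    by (rule inj_onI) (metis add_right_cancel g(2))
  then have "card ?R = card ((\<lambda>r. g r + b) ` ?R)"
    by (simp add: card_image)
  moreover have "card (T \<union> (\<lambda>r. g r + b) ` ?R) = card T + card ((\<lambda>r. g r + b) ` ?R)"
    using assms g(3) by (intro card_Un_disjoint) auto
  moreover have "card (T \<union> (\<lambda>r. g r + b) ` ?R) \<le> card (T \<union> (\<lambda>x. x + b) ` T)"
    using assms g(1) by (intro card_mono) auto
  ultimately show ?thesis by linarith
qed

lemma card_sums0_insert:
  assumes "finite B" "b \<notin> B" "b > 0"
  shows "card (sums0 B) + card (msums b B) \<le> card (sums0 (insert b B))"
  using card_Un_translate[of "sums0 B" b] assms by (simp add: sums0_insert msums_def)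

text \<open>This is |sums| \<ge> 1 + n(n+1)/2, doubled to avoid division. Elements are adjoined in
  increasing order: those already present lie below the new \<open>b\<close>, so together with 0
  they represent distinct classes modulo \<open>b\<close>, and each class yields a new sum.\<close>

lemma card_sums0_ge:
  assumes "finite B" "\<forall>b\<in>B. b > 0"
  shows "card B * (card B + 1) + 2 \<le> 2 * card (sums0 B)"
  using assms
proof (induction B rule: finite_linorder_max_induct)
  case empty
  then show ?case by simp
next
  case (insert b B)
  then have "b \<notin> B" "B \<subseteq> {0<..<b}" "b > 0" by auto
  then have "card (sums0 B) + Suc (card B) \<le> card (sums0 (insert b B))"
    using card_sums0_insert[of B b] card_msums_ge_Suc[of b B] insert by linarith
  with insert \<open>b \<notin> B\<close> show ?case by (simp add: algebra_simps)
qed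

section \<open>Translations modulo \<open>m\<close> and near-periodic residue sets\<close>

lemma inj_on_add_mod: "inj_on (\<lambda>x. (x + d) mod m) {0..<m::int}"
proof (rule inj_onI)
  fix x y :: int
  assume xy: "x \<in> {0..<m}" "y \<in> {0..<m}" and "(x + d) mod m = (y + d) mod m"
  then have "((x + d) mod m - d) mod m = ((y + d) mod m - d) mod m" by simp
  then have "x mod m = y mod m" by (simp add: mod_simps)
  then show "x = y" using xy by simp
qed

text \<open>An injective self-map of a finite set is a permutation, so the inverse translation
  preserves \<open>U\<close> as well.\<close>

lemma closed_add_mod_imp_closed_diff_mod:
  fixes m :: int
  assumes "U \<subseteq> {0..<m}" "\<forall>x\<in>U. (x + d) mod m \<in> U" "x \<in> U"
  shows "(x - d) mod m \<in> U"
proof -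
  have "finite U" using assms(1) by (rule finite_subset) simp
  moreover have "inj_on (\<lambda>x. (x + d) mod m) U"
    using inj_on_add_mod assms(1) by (rule inj_on_subset)
  ultimately have "(\<lambda>x. (x + d) mod m) ` U = U"
    using assms(2) by (intro endo_inj_surj) auto
  then obtain u where u: "u \<in> U" "x = (u + d) mod m" using assms(3) by auto
  then have "(x - d) mod m = u mod m" by (simp add: mod_simps)
  then show ?thesis using u assms(1) by auto
qed

text \<open>
  Modulo \<open>m\<close>, the set \<open>S\<close> is a union of cosets of \<open>\<langle>c\<rangle>\<close> together with one progression of
  difference \<open>c\<close> and length at least two; \<open>q\<close> is its last and \<open>q'\<close> its first element.
\<close>

definition near_periodic :: "int \<Rightarrow> int set \<Rightarrow> int \<Rightarrow> int \<Rightarrow> int \<Rightarrow> bool" where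
  "near_periodic m S c q q' \<longleftrightarrow> q \<in> S \<and> q' \<in> S \<and> q \<noteq> q' \<and> (q + c) mod m \<notin> S \<and>
    (\<forall>x\<in>S. (x + c) mod m \<notin> S \<longrightarrow> x = q) \<and> (\<forall>x\<in>S. (x - c) mod m \<notin> S \<longrightarrow> x = q')"

text \<open>If \<open>p\<close> is neither \<open>q\<close> nor \<open>q'\<close>, then
  \<open>p + c\<close> and \<open>p - c\<close> lie in \<open>S\<close> and differ from
  \<open>p\<close>, so adding \<open>b\<close> keeps them in \<open>S\<close>. The missing point
  \<open>p + b\<close> thus has both neighbours at distance \<open>c\<close> in \<open>S\<close>,
  which forces them to be \<open>q\<close> and \<open>q'\<close>. The excluded divisibilities rule
  out \<open>p = q\<close> and \<open>p = q'\<close>.\<close>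

lemma near_periodic_common_gap:
  assumes S: "S \<subseteq> {0..<m}"
    and b: "near_periodic m S b p p'" and c: "near_periodic m S c q q'"
    and ndvd: "\<not> m dvd c" "\<not> m dvd b - c" "\<not> m dvd b + c"
  shows "(p + b) mod m = (q + c) mod m" "((p + b) mod m + c) mod m \<in> S"
proof -
  have p: "p \<in> S" "(p + b) mod m \<notin> S" "\<And>x. x \<in> S \<Longrightarrow> (x + b) mod m \<notin> S \<Longrightarrow> x = p"
    using b by (auto simp: near_periodic_def)
  have q: "q \<in> S" "q' \<in> S" "q \<noteq> q'" "\<And>x. x \<in> S \<Longrightarrow> (x + c) mod m \<notin> S \<Longrightarrow> x = q"
     "\<And>x. x \<in> S \<Longrightarrow> (x - c) mod m \<notin> S \<Longrightarrow> x = q'"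
    using c by (auto simp: near_periodic_def)
  have small: "m dvd d" if "(p + d) mod m = p" for d
  proof -
    have "(p + d) mod m = p mod m" using that p(1) S by auto
    then have "m dvd p + d - p" by (rule mod_eq_dvd_iff[THEN iffD1])
    then show ?thesis by simp
  qed
  have A: "(p + b + c) mod m = q'" if "p \<noteq> q"
  proof -
    have "(p + c) mod m \<in> S" using q(4) p(1) that by blast
    moreover have "(p + c) mod m \<noteq> p" using small ndvd by blast
    ultimately have "((p + c) mod m + b) mod m \<in> S" using p(3) by blast
    then have "(p + b + c) mod m \<in> S" by (simp add: mod_simps add_ac)
    moreover have "((p + b + c) mod m - c) mod m \<notin> S" using p(2) by (simp add: mod_simps)
    ultimately show ?thesis using q(5) by blast
  qed
  have B: "(p + b - c) mod m = q" if "p \<noteq> q'"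
  proof -
    have "(p + - c) mod m \<in> S" using q(5) p(1) that by fastforce
    moreover have "(p + - c) mod m \<noteq> p" using small[of "- c"] ndvd by auto
    ultimately have "((p + - c) mod m + b) mod m \<in> S" using p(3) by blast
    then have "(p + b - c) mod m \<in> S" by (simp add: mod_simps algebra_simps)
    moreover have "((p + b - c) mod m + c) mod m \<notin> S" using p(2) by (simp add: mod_simps)
    ultimately show ?thesis using q(4) by blast
  qed
  have "p \<noteq> q"
  proof
    assume "p = q"
    then have "(p + (b - c)) mod m = p" using B q(3) by (simp add: add_diff_eq)
    then show False using small ndvd by blast
  qed
  moreover have "p \<noteq> q'"
  proof
    assume "p = q'"
    then have "(p + (b + c)) mod m = p" using A q(3) by (simp add: add.assoc)
    then show False using small ndvd by blast
  qed
  ultimately have *: "(p + b + c) mod m = q'" "(p + b - c) mod m = q" using A B by auto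
  then show "((p + b) mod m + c) mod m \<in> S" using q(2) by (simp add: mod_simps)
  have "((p + b - c) mod m + c) mod m = (p + b) mod m" by (simp add: mod_simps)
  then show "(p + b) mod m = (q + c) mod m" using * by simp
qed

text \<open>\<open>S\<close> is the union of \<open>S'\<close> and its translate \<open>T\<close>,
  which have equal size. As \<open>q\<close> is missing from \<open>S'\<close>, each of them lacks
  exactly one point of \<open>S\<close>: \<open>S'\<close> lacks \<open>q\<close> and
  \<open>T\<close> lacks \<open>q'\<close>. A point that leaves \<open>S\<close> under adding
  \<open>c\<close> cannot be in \<open>S'\<close>; one that leaves under subtracting
  \<open>c\<close> cannot be in \<open>T\<close>.\<close>

lemma near_periodic_msums:
  assumes m: "m > 0" and B: "finite B" and "c \<in> B"
    and card: "card (msums m B) \<le> card (msums m (B - {c})) + 1"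
    and q: "q \<in> msums m B" "(q + c) mod m \<notin> msums m B"
  shows "\<exists>q'. near_periodic m (msums m B) c q q'"
proof -
  define S where "S = msums m B"
  define S' where "S' = msums m (B - {c})"
  define T where "T = (\<lambda>x. (x + c) mod m) ` S'"
  have fin: "finite S" "finite S'" using B by (auto simp: S_def S'_def)
  have ST: "S = S' \<union> T"
    using msums_insert[of "B - {c}" c m] B \<open>c \<in> B\<close>
    by (simp add: S_def S'_def T_def insert_absorb)
  have S'm: "S' \<subseteq> {0..<m}" using m by (simp add: S'_def msums_subset)
  have "card T = card S'"
    unfolding T_def by (intro card_image inj_on_subset[OF inj_on_add_mod S'm])
  have qS: "q \<in> S" "(q + c) mod m \<notin> S" using q by (auto simp: S_def)
  then have "q \<notin> S'" using ST by (auto simp: T_def)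
  then have "q \<in> T" using qS ST by auto
  have "card (insert q S') = card S' + 1" using fin \<open>q \<notin> S'\<close> by simp
  then have Sq: "insert q S' = S"
    using card qS ST fin by (intro card_seteq) (auto simp: S_def S'_def)
  then have "card S = card S' + 1" using \<open>card (insert q S') = card S' + 1\<close> by simp
  then have "card (S - T) = 1"
    using ST fin \<open>card T = card S'\<close> by (subst card_Diff_subset) auto
  then obtain q' where q': "S - T = {q'}" by (auto simp: card_1_singleton_iff)
  have "x = q" if "x \<in> S" "(x + c) mod m \<notin> S" for x
    using that Sq ST by (auto simp: T_def)
  moreover have "x = q'" if "x \<in> S" "(x - c) mod m \<notin> S" for x
  proof -
    have "x \<notin> T"
    proof
      assume "x \<in> T"
      then obtain s where s: "s \<in> S'" "x = (s + c) mod m" by (auto simp: T_def)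
      then have "(x - c) mod m = s mod m" by (simp add: mod_simps)
      then have "(x - c) mod m = s" using s S'm by auto
      then show False using that s ST by auto
    qed
    then show ?thesis using that q' by auto
  qed
  ultimately have "near_periodic m S c q q'"
    using qS q' \<open>q \<in> T\<close> unfolding near_periodic_def by blast
  then show ?thesis unfolding S_def by blast
qed

section \<open>Residue sets that are closed, or closed up to one gap\<close>

lemma msums_closed_add:
  assumes "finite B" and closed: "\<forall>b\<in>B. \<forall>x\<in>msums m B. (x + b) mod m \<in> msums m B"
    and "x \<in> msums m B" "s \<in> msums m B"
  shows "(x + s) mod m \<in> msums m B"
proof -
  obtain X where X: "X \<subseteq> B" "s = \<Sum>X mod m"
    using assms by (auto simp: msums_def sums0_def)
  have "finite X" using X assms finite_subset by blast
  then have "(x + \<Sum>X) mod m \<in> msums m B" using X(1)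
  proof (induction X)
    case empty
    have "x mod m = x" using assms by (auto simp: msums_def)
    then show ?case using assms by simp
  next
    case (insert b X)
    then have "((x + \<Sum>X) mod m + b) mod m \<in> msums m B" using closed by blast
    moreover have "((x + \<Sum>X) mod m + b) mod m = (x + \<Sum>(insert b X)) mod m"
      using insert by (simp add: mod_simps add_ac)
    ultimately show ?case by simp
  qed
  then show ?thesis by (simp add: X mod_simps)
qed

text \<open>\<open>S'\<close> is a subgroup, so its coset \<open>T\<close> is either disjoint from
  it or equal to it. Equality would give \<open>S = S'\<close> closed under adding \<open>c\<close>,
  against the choice of \<open>q\<close>.\<close>

lemma card_msums_double:
  assumes m: "m > 0" and B: "finite B" "c \<in> B"
    and closed: "\<forall>b\<in>B-{c}. \<forall>x\<in>msums m (B-{c}). (x + b) mod m \<in> msums m (B-{c})"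
    and q: "q \<in> msums m B" "(q + c) mod m \<notin> msums m B"
  shows "card (msums m B) = 2 * card (msums m (B - {c}))"
proof -
  define S where "S = msums m B"
  define S' where "S' = msums m (B - {c})"
  define T where "T = (\<lambda>x. (x + c) mod m) ` S'"
  have fin: "finite S" "finite S'" using B by (auto simp: S_def S'_def)
  have ST: "S = S' \<union> T"
    using msums_insert[of "B - {c}" c m] B by (simp add: S_def S'_def T_def insert_absorb)
  have S'm: "S' \<subseteq> {0..<m}" using m by (simp add: S'_def msums_subset)
  have add: "(x + s) mod m \<in> S'" if "x \<in> S'" "s \<in> S'" for x s
    using msums_closed_add[OF _ closed] that B by (simp add: S'_def)
  have "S' \<inter> T = {}"
  proof (rule ccontr)
    assume "S' \<inter> T \<noteq> {}"
    then obtain t where t: "t \<in> S'" "(t + c) mod m \<in> S'" by (auto simp: T_def)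
    have "(x + c) mod m \<in> S'" if "x \<in> S'" for x
    proof -
      have "(x - t) mod m \<in> S'"
        using closed_add_mod_imp_closed_diff_mod[OF S'm, of t x] add t that by blast
      then have "((x - t) mod m + (t + c) mod m) mod m \<in> S'" using add t by blast
      then show ?thesis by (simp add: mod_simps)
    qed
    then have "S = S'" "(q + c) mod m \<in> S'" using ST q by (auto simp: T_def S_def)
    then show False using q by (simp add: S_def)
  qed
  then have "card S = card S' + card T"
    unfolding ST using fin by (intro card_Un_disjoint) (auto simp: T_def)
  moreover have "card T = card S'"
    unfolding T_def by (intro card_image inj_on_subset[OF inj_on_add_mod S'm])
  ultimately show ?thesis by (simp add: S_def S'_def)
qed

text \<open>
  If \<open>y\<close> is not a subset sum, reflecting \<open>insert 0 B\<close> in \<open>y\<close> moves it off itself, except for the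
  at most two solutions of \<open>2b = y\<close>.
\<close>

lemma card_ge_if_one_gap:
  assumes m: "m > 0" and B: "finite B" "B \<subseteq> {0<..<m}"
    and y: "0 \<le> y" "y < m" "y \<notin> msums m B"
    and closed: "\<forall>b\<in>B. \<forall>x\<in>insert y (msums m B). (x + b) mod m \<in> insert y (msums m B)"
  shows "2 * card B \<le> card (msums m B) + 1"
proof -
  define S where "S = msums m B"
  define U where "U = insert y S"
  define B0 where "B0 = insert 0 B"
  define V where "V = {b \<in> B0. (2 * b) mod m = y}"
  define f where "f b = (y - b) mod m" for b
  have Um: "U \<subseteq> {0..<m}" using m msums_subset[of m B] y by (auto simp: U_def S_def)
  have fin: "finite S" "finite U" "finite B0" using B by (auto simp: S_def U_def B0_def)
  have B0m: "B0 \<subseteq> {0..<m}" using B m by (auto simp: B0_def)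
  have "0 \<notin> B" using B by auto
  then have cB0: "card B0 = card B + 1" using B by (simp add: B0_def)
  have "B0 \<subseteq> S" using residues_subset_msums[OF m B(2)] by (simp add: S_def B0_def)
  have cU: "card U = card S + 1" using y fin by (simp add: U_def S_def)
  have "V \<subseteq> {y div 2, (y + m) div 2}"
  proof
    fix b assume "b \<in> V"
    then have b: "0 \<le> b" "b < m" "(2 * b) mod m = y" using B0m by (auto simp: V_def)
    show "b \<in> {y div 2, (y + m) div 2}"
    proof (cases "2 * b < m")
      case True
      then have "2 * b = y" using b by simp
      then show ?thesis by auto
    next
      case False
      then have "(2 * b - m) mod m = 2 * b - m" using b by (intro mod_pos_pos_trivial) auto
      then have "2 * b = y + m" using b(3) by simp
      then have "b = (y + m) div 2" by linarith
      then show ?thesis by simp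
    qed
  qed
  then have "card V \<le> card {y div 2, (y + m) div 2}" by (intro card_mono) auto
  also have "\<dots> \<le> 2" by (simp add: card_insert_if)
  finally have cV: "card V \<le> 2" .
  have yb: "f b \<in> U" if "b \<in> B0" for b
  proof (cases "b = 0")
    case True
    then show ?thesis using y by (simp add: U_def f_def)
  next
    case False
    then have "b \<in> B" using that by (simp add: B0_def)
    then have "\<forall>x\<in>U. (x + b) mod m \<in> U" using closed by (auto simp: U_def S_def)
    then show ?thesis
      unfolding f_def using closed_add_mod_imp_closed_diff_mod[OF Um] by (simp add: U_def)
  qed
  have two: "(b + b') mod m \<in> S" if "b \<in> B0" "b' \<in> B0" "b \<noteq> b'" for b b'
  proof -
    have "\<Sum>({b, b'} - {0}) = b + b'" "{b, b'} - {0} \<subseteq> B"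
      using that by (auto simp: B0_def insert_Diff_if)
    then have "b + b' \<in> sums0 B" unfolding sums0_def by (metis PowI image_eqI)
    then show ?thesis by (simp add: S_def msums_def)
  qed
  \<comment> \<open>Otherwise \<open>b\<close> and \<open>f b\<close> would be two distinct elements
    of \<open>B0\<close> with sum \<open>y\<close>, making \<open>y\<close> a subset sum.\<close>
  have "f b \<notin> B0" if "b \<in> B0 - V" for b
  proof
    assume "f b \<in> B0"
    have sum: "(b + f b) mod m = y" using y by (simp add: f_def mod_simps)
    have "b \<noteq> f b"
    proof
      assume "b = f b"
      then have "(2 * b) mod m = y" using sum by (metis mult_2)
      then show False using that by (simp add: V_def)
    qed
    then have "(b + f b) mod m \<in> S" using two[of b "f b"] that \<open>f b \<in> B0\<close> by blast
    then have "y \<in> S" by (simp only: sum)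
    then show False using y by (simp add: S_def)
  qed
  then have "f ` (B0 - V) \<subseteq> U - B0" using yb by auto
  moreover have "inj_on f (B0 - V)"
  proof (rule inj_onI)
    fix u v assume uv: "u \<in> B0 - V" "v \<in> B0 - V" "f u = f v"
    then have "(y - f u) mod m = (y - f v) mod m" by simp
    then have "u mod m = v mod m" by (simp add: f_def mod_simps)
    moreover have "u \<in> {0..<m}" "v \<in> {0..<m}" using uv B0m by blast+
    ultimately show "u = v" by simp
  qed
  ultimately have "card (B0 - V) \<le> card (U - B0)"
    using fin by (metis card_image card_mono finite_Diff)
  moreover have "card (B0 - V) = card B0 - card V"
    using fin by (intro card_Diff_subset) (auto simp: V_def)
  moreover have "card (U - B0) = card U - card B0"
    using fin \<open>B0 \<subseteq> S\<close> by (intro card_Diff_subset) (auto simp: U_def)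
  moreover have "card B0 \<le> card U" using fin \<open>B0 \<subseteq> S\<close> by (intro card_mono) (auto simp: U_def)
  \<comment> \<open>With n = |B| the count reads (n + 1) - 2 \<le> (|S| + 1) - (n + 1).\<close>
  ultimately show ?thesis using cV cU cB0 by (simp add: S_def)
qed

section \<open>The dichotomy for residues of subset sums\<close>

text \<open>The second alternative says that the residues form the subgroup generated by
  \<open>B\<close>, which may be too small for the first bound.\<close>

lemma card_msums_ge:
  assumes m: "m > 0" and "finite B" "B \<subseteq> {0<..<m}"
  shows "2 * card B \<le> card (msums m B) + 1 \<or>
    (\<forall>b\<in>B. \<forall>x\<in>msums m B. (x + b) mod m \<in> msums m B)"
  using assms(2,3)
proof (induction B rule: finite_psubset_induct)
  case (psubset B)
  define S where "S = msums m B"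
  have Sm: "S \<subseteq> {0..<m}" using m by (simp add: S_def msums_subset)
  show ?case
  proof (rule ccontr)
    assume contr: "\<not> ?thesis"
    then have small: "card S + 1 < 2 * card B" by (simp add: S_def)
    have "card B + 1 \<le> card S"
      using card_msums_ge_Suc[OF m psubset.prems psubset.hyps] by (simp add: S_def)
    \<comment> \<open>Three elements guarantee one outside \<open>{c, m - c}\<close> below.\<close>
    then have "card B \<ge> 3" using small by linarith
    have ndvd: "\<not> m dvd b" if "b \<in> B" for b
      using that psubset.prems zdvd_not_zless by auto
    \<comment> \<open>Removing \<open>c\<close> loses at most one sum: if the first alternative
      holds for \<open>B - {c}\<close>, a larger loss would contradict \<open>small\<close>; if the
      second holds, doubling would give at least 2|B| sums, which \<open>small\<close>
      forbids.\<close>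
    have near: "\<exists>q'. near_periodic m S c q q'" if c: "c \<in> B" "q \<in> S" "(q + c) mod m \<notin> S" for c q
    proof -
      have cB: "card (B - {c}) = card B - 1" using c psubset.hyps by simp
      have "B - {c} \<subset> B" "B - {c} \<subseteq> {0<..<m}" using c psubset.prems by auto
      from psubset.IH[OF this] have "card S \<le> card (msums m (B - {c})) + 1"
      proof
        assume "2 * card (B - {c}) \<le> card (msums m (B - {c})) + 1"
        then show ?thesis using small cB by simp
      next
        assume "\<forall>b\<in>B-{c}. \<forall>x\<in>msums m (B-{c}). (x + b) mod m \<in> msums m (B-{c})"
        then have "card S = 2 * card (msums m (B - {c}))"
          using card_msums_double[OF m psubset.hyps] c by (simp add: S_def)
        moreover have "Suc (card (B - {c})) \<le> card (msums m (B - {c}))"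
          using \<open>B - {c} \<subseteq> {0<..<m}\<close> psubset.hyps m by (intro card_msums_ge_Suc) auto
        ultimately show ?thesis using small cB by linarith
      qed
      then show ?thesis
        using near_periodic_msums[OF m psubset.hyps] c by (simp add: S_def)
    qed
    obtain c q where c: "c \<in> B" "q \<in> S" "(q + c) mod m \<notin> S"
      using contr by (auto simp: S_def)
    obtain q' where q': "near_periodic m S c q q'" using near[OF c] by blast
    \<comment> \<open>If \<open>S\<close> were closed under adding \<open>d\<close>, then
      \<open>q + d\<close> would be another point of \<open>S\<close> that leaves it under adding
      \<open>c\<close>; uniqueness of \<open>q\<close> would then force \<open>m\<close> to divide
      \<open>d\<close>.\<close>
    have "\<exists>p p'. near_periodic m S d p p'" if d: "d \<in> B" for d
    proof (cases "\<forall>x\<in>S. (x + d) mod m \<in> S")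
      case True
      then have "(q + d) mod m \<in> S" using c by blast
      moreover have "((q + d) mod m + c) mod m \<notin> S"
      proof
        assume "((q + d) mod m + c) mod m \<in> S"
        then have "(((q + d) mod m + c) mod m - d) mod m \<in> S"
          by (rule closed_add_mod_imp_closed_diff_mod[OF Sm True])
        then show False using c by (simp add: mod_simps)
      qed
      ultimately have "(q + d) mod m = q" using q' unfolding near_periodic_def by blast
      moreover have "q mod m = q" using c Sm by auto
      ultimately have "m dvd q + d - q" by (metis mod_eq_dvd_iff)
      then show ?thesis using ndvd[OF d] by simp
    next
      case False
      then show ?thesis using near d by blast
    qed
    then obtain p p' where pp: "\<And>d. d \<in> B \<Longrightarrow> near_periodic m S d (p d) (p' d)" by metis
    have gap: "(p b + b) mod m = (p d + d) mod m" "((p b + b) mod m + d) mod m \<in> S"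
      if bd: "b \<in> B" "d \<in> B" "b \<noteq> d" "b + d \<noteq> m" for b d
    proof -
      have r: "0 < b" "b < m" "0 < d" "d < m" using bd psubset.prems by auto
      have "\<not> m dvd b - d"
      proof
        assume "m dvd b - d"
        then have "b mod m = d mod m" by (simp add: mod_eq_dvd_iff)
        then show False using bd r by simp
      qed
      moreover have "\<not> m dvd b + d"
      proof
        assume "m dvd b + d"
        then have "m dvd b + d - m" by simp
        then have "b + d - m = 0" using r dvd_imp_le_int[of "b + d - m" m] by linarith
        then show False using bd by simp
      qed
      ultimately show "(p b + b) mod m = (p d + d) mod m" "((p b + b) mod m + d) mod m \<in> S"
        using near_periodic_common_gap[OF Sm pp[OF bd(1)] pp[OF bd(2)]] ndvd bd by auto
    qed
    have "\<not> B \<subseteq> {c, m - c}"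
    proof
      assume "B \<subseteq> {c, m - c}"
      then have "card B \<le> card {c, m - c}" by (intro card_mono) auto
      also have "\<dots> \<le> 2" by (simp add: card_insert_if)
      finally show False using \<open>card B \<ge> 3\<close> by simp
    qed
    \<comment> \<open>\<open>gap\<close> does not compare \<open>c\<close> with itself or with
      \<open>m - c\<close>. The element \<open>e\<close> is comparable with all of these and links
      their gaps to that of \<open>c\<close>.\<close>
    then obtain e where e: "e \<in> B" "e \<noteq> c" "c + e \<noteq> m" by force
    define y where "y = (p c + c) mod m"
    have y: "(p d + d) mod m = y \<and> (y + d) mod m \<in> S" if d: "d \<in> B" for d
    proof (cases "d \<noteq> c \<and> c + d \<noteq> m")
      case True
      then show ?thesis using gap[of c d] d c by (simp add: y_def)
    next
      case False
      then have "e \<noteq> d" "e + d \<noteq> m" using e by auto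
      then have "(p e + e) mod m = (p d + d) mod m" "((p e + e) mod m + d) mod m \<in> S"
        using gap[of e d] e d by auto
      moreover have "y = (p e + e) mod m" using gap[of c e] e c by (simp add: y_def)
      ultimately show ?thesis by simp
    qed
    \<comment> \<open>Adjoining \<open>y\<close> closes \<open>S\<close>: the only exit under adding
      \<open>b\<close> goes from \<open>p b\<close> to \<open>y\<close>, and \<open>y + b\<close> is
      back in \<open>S\<close>.\<close>
    have "2 * card B \<le> card (msums m B) + 1"
    proof (rule card_ge_if_one_gap[OF m psubset.hyps psubset.prems])
      show "0 \<le> y" "y < m" using m by (auto simp: y_def)
      show "y \<notin> msums m B" using pp[OF c(1)] by (simp add: y_def near_periodic_def S_def)
      show "\<forall>b\<in>B. \<forall>x\<in>insert y (msums m B). (x + b) mod m \<in> insert y (msums m B)"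
      proof (intro ballI)
        fix b x assume "b \<in> B" and x: "x \<in> insert y (msums m B)"
        then have "x \<in> S \<Longrightarrow> (x + b) mod m \<notin> S \<Longrightarrow> x = p b"
          using pp by (auto simp: near_periodic_def)
        then show "(x + b) mod m \<in> insert y (msums m B)"
          using y[OF \<open>b \<in> B\<close>] x by (auto simp: S_def)
      qed
    qed
    then show False using small by (simp add: S_def)
  qed
qed

section \<open>Closed residue sets when the gcd is one\<close>

lemma Gcd_mem_if_closed:
  fixes H :: "int set"
  assumes "finite A" "A \<subseteq> H" "0 \<in> H"
    and lin: "\<And>x y u v. x \<in> H \<Longrightarrow> y \<in> H \<Longrightarrow> u * x + v * y \<in> H"
  shows "Gcd A \<in> H"
  using assms(1,2)
proof (induction A)
  case empty
  then show ?case using assms by simp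
next
  case (insert a A)
  obtain u v where "u * a + v * Gcd A = gcd a (Gcd A)" using bezout_int by blast
  then show ?case using lin[of a "Gcd A" u v] insert by simp
qed

text \<open>The integers whose translation preserves \<open>S\<close> form a subgroup
  \<open>H\<close> containing \<open>A\<close>, hence containing \<open>Gcd A = 1\<close>. So every
  translate of 0 is in \<open>S\<close>.\<close>

lemma card_residues_of_closed:
  assumes m: "m > 0" and S: "S \<subseteq> {0..<m}" "0 \<in> S"
    and A: "finite A" "Gcd A = 1"
    and closed: "\<forall>b\<in>A. \<forall>x\<in>S. (x + b) mod m \<in> S"
  shows "card S = nat m"
proof -
  define H where "H = {d. \<forall>x\<in>S. (x + d) mod m \<in> S}"
  have H0: "0 \<in> H" using S by (force simp: H_def)
  have Hadd: "d + e \<in> H" if "d \<in> H" "e \<in> H" for d e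
  proof -
    have "((x + d) mod m + e) mod m \<in> S" if "x \<in> S" for x
      using that \<open>d \<in> H\<close> \<open>e \<in> H\<close> by (auto simp: H_def)
    then show ?thesis by (simp add: H_def mod_simps add.assoc)
  qed
  have Hneg: "- d \<in> H" if "d \<in> H" for d
    using that closed_add_mod_imp_closed_diff_mod[OF S(1)] by (auto simp: H_def)
  have Hnat: "int n * d \<in> H" if "d \<in> H" for n d
    using that by (induction n) (auto simp: H0 Hadd algebra_simps)
  have Hmul: "u * d \<in> H" if "d \<in> H" for u d
  proof (cases "u \<ge> 0")
    case True
    then show ?thesis using Hnat[OF that, of "nat u"] by simp
  next
    case False
    then show ?thesis using Hneg[OF Hnat[OF that, of "nat (- u)"]] by simp
  qed
  have "A \<subseteq> H" using closed by (auto simp: H_def)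
  then have "Gcd A \<in> H"
    using A H0 by (intro Gcd_mem_if_closed) (auto simp: Hadd Hmul)
  then have "x \<in> H" for x using Hmul[of 1 x] A by simp
  then have "(0 + x) mod m \<in> S" for x using S(2) unfolding H_def by blast
  moreover have "(0 + x) mod m = x" if "x \<in> {0..<m}" for x using that by simp
  ultimately have "x \<in> S" if "x \<in> {0..<m}" for x using that by metis
  then have "S = {0..<m}" using S(1) by blast
  then show ?thesis by simp
qed

section \<open>Adjoining the largest element and the final estimate\<close>

lemma card_sums0_insert_Max_ge:
  assumes B: "finite B" "B \<subseteq> {0<..<m}" and m: "m > 0" and gcd: "Gcd (insert m B) = 1"
  shows "card (sums0 B) + min (nat m) (2 * card B - 1) \<le> card (sums0 (insert m B))"
proof -
  have "card (msums m B) = nat m"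
    if "\<forall>b\<in>B. \<forall>x\<in>msums m B. (x + b) mod m \<in> msums m B"
  proof (rule card_residues_of_closed[OF m _ _ _ gcd])
    show "msums m B \<subseteq> {0..<m}" using m by (rule msums_subset)
    show "0 \<in> msums m B" using residues_subset_msums[OF m B(2)] by simp
    show "finite (insert m B)" using B by simp
    \<comment> \<open>Adding \<open>m\<close> itself does not change a residue.\<close>
    show "\<forall>b\<in>insert m B. \<forall>x\<in>msums m B. (x + b) mod m \<in> msums m B"
      using that by (auto simp: msums_def)
  qed
  then have "min (nat m) (2 * card B - 1) \<le> card (msums m B)"
    using card_msums_ge[OF m B] by linarith
  moreover have "m \<notin> B" using B by auto
  ultimately show ?thesis using card_sums0_insert[of B m] B m by linarith
qed

text \<open>By positivity only the empty set has sum 0, so discarding the empty sum removes exactly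
  one value.\<close>

lemma subset_sums_eq_sums0:
  assumes "finite A" "\<forall>b\<in>A. b > 0"
  shows "subset_sums A = sums0 A - {0}"
proof -
  have pos: "\<Sum>X \<noteq> 0" if "X \<noteq> {}" "X \<subseteq> A" for X
  proof -
    have "finite X" using that(2) assms(1) by (rule finite_subset)
    then have "\<Sum>X > 0" using that assms(2) by (intro sum_pos) auto
    then show ?thesis by simp
  qed
  have "subset_sums A = \<Sum> ` (Pow A - {{}})"
    by (auto simp: subset_sums_def)
  also have "\<dots> = sums0 A - {0}"
    unfolding sums0_def using pos by auto
  finally show ?thesis .
qed

theorem theorem3p2:
  fixes k :: nat and a :: "nat \<Rightarrow> int" and A :: "int set"
  assumes "k \<ge> 3"
    and "A = a ` {1..k}"
    and "strict_mono_on {1..k} a"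
    and "\<forall>i\<in>{1..k}. a i > 0"
    and "Gcd A = 1"
  shows "(a k \<le> 2 * int k - 3 \<longrightarrow>
            real (card (subset_sums A)) \<ge> real_of_int (a k) + real k * (real k - 1) / 2) \<and>
         (a k \<ge> 2 * int k - 2 \<longrightarrow>
            real (card (subset_sums A)) \<ge>
              golden_mean * (real k + 1) - 4 + real k * (real k - 1) / 2)"
proof -
  define B where "B = a ` {1..<k}"
  have "{1..k} = insert k {1..<k}" using assms(1) by auto
  then have AB: "A = insert (a k) B" by (simp add: assms(2) B_def)
  have "inj_on a {1..k}" using assms(3) by (rule strict_mono_on_imp_inj_on)
  then have "inj_on a {1..<k}" by (rule inj_on_subset) auto
  then have cB: "card B = k - 1" by (simp add: B_def card_image)
  have ak: "a k > 0" using assms by auto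
  have B: "finite B" "B \<subseteq> {0<..<a k}"
    using assms(1,3,4) by (auto simp: B_def strict_mono_on_def)
  have fin: "finite A" using B AB by simp
  have "\<forall>b\<in>A. b > 0" using assms by auto
  then have "card (subset_sums A) = card (sums0 A) - 1"
    using subset_sums_eq_sums0[OF fin] zero_in_sums0 by (simp add: card_Diff_singleton)
  moreover have "card (sums0 A) > 0" using fin zero_in_sums0 card_gt_0_iff by fastforce
  ultimately have c1: "card (sums0 A) = card (subset_sums A) + 1" by simp
  have c2: "card (sums0 B) + min (nat (a k)) (2 * k - 3) \<le> card (sums0 A)"
    using card_sums0_insert_Max_ge[OF B ak] assms(5) cB by (simp add: AB)
  have "\<forall>b\<in>B. b > 0" using B(2) by auto
  then have "(k - 1) * k + 2 \<le> 2 * card (sums0 B)"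
    using card_sums0_ge[OF B(1)] cB assms(1) by simp
  then have "real ((k - 1) * k + 2) \<le> real (2 * card (sums0 B))" by (rule of_nat_mono)
  then have c3: "real k * (real k - 1) / 2 + 1 \<le> real (card (sums0 B))"
    using assms(1) by (simp add: of_nat_diff field_simps)
  \<comment> \<open>The 1 in \<open>c3\<close> cancels against the empty sum counted in
    \<open>c1\<close>.\<close>
  have main: "real k * (real k - 1) / 2 + real (min (nat (a k)) (2 * k - 3)) \<le> real (card (subset_sums A))"
    using c1 c2 c3 by linarith
  show ?thesis
  proof (intro conjI impI)
    assume "a k \<le> 2 * int k - 3"
    then have "min (nat (a k)) (2 * k - 3) = nat (a k)" using assms(1) by auto
    then show "real (card (subset_sums A)) \<ge> real_of_int (a k) + real k * (real k - 1) / 2"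
      using main ak by simp
  next
    assume "a k \<ge> 2 * int k - 2"
    then have "min (nat (a k)) (2 * k - 3) = 2 * k - 3" using assms(1) by auto
    then have main': "real k * (real k - 1) / 2 + (2 * real k - 3) \<le> real (card (subset_sums A))"
      using main assms(1) by (simp add: of_nat_diff)
    \<comment> \<open>What is needed is \<theta>(k+1) - 4 \<le> 2k - 3. With 7/4 in place of
      \<theta> this is equivalent to k \<ge> 3, so the crude bound suffices.\<close>
    have "sqrt 5 \<le> 5 / 2" by (rule real_le_lsqrt) (auto simp: power2_eq_square)
    then have "golden_mean \<le> 7 / 4" by (simp add: golden_mean_def)
    then have "golden_mean * (real k + 1) \<le> 7 / 4 * (real k + 1)" by (intro mult_right_mono) auto
    then show "real (card (subset_sums A)) \<ge>
        golden_mean * (real k + 1) - 4 + real k * (real k - 1) / 2"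
      using main' assms(1) by simp
  qed
qed

end
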